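(* Let $m>1$ be an integer and $n=2m+1$. Let $X_1,\dots,X_m,T_1,\dots,T_m$ be random variables, each uniformly distributed on $[-1,1]$, and let $B$ be a discrete random variable uniform on $\{-1,1\}$, such that $X_1,\dots,X_m,T_1,\dots,T_m,B$ are mutually independent. Let $$S_k=X_k-X_{k+1}\quad(k=1,\dots,m-2),\qquad S_{m-1}=X_{m-1}-\tfrac12(X_m+B),\qquad S_m=-\tfrac12(X_m-B)-X_1,$$ and $$Y_{2k-1}=\frac{S_k}{2}+\left(1-\frac{|S_k|}{2}\right)T_k,\qquad Y_{2k}=\frac{S_k}{2}-\left(1-\frac{|S_k|}{2}\right)T_k\qquad (k=1,\dots,m),\qquad Y_{2m+1}=X_m.$$ Let $\sigma$ be a random permutation of $\{1,\dots,n\}$, chosen uniformly and independently of $\vec Y=(Y_1,\dots,Y_n)$. Then $\vec W=\sigma(\vec Y):=(Y_{\sigma(1)},\dots,Y_{\sigma(n)})$ is a random balanced sample of size $n$ whose distribution has all of $M(n)$ as its support.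
   Context: A random balanced sample (RBS) of size $n$ is a system of random variables $\vec X=(X_1,\dots,X_n)$ such that $\sum_{k=1}^n X_k=0$ and each $X_k$ is uniformly distributed on $[-1,1]$. $M(n)=\{\vec x\in[-1,1]^n:\sum_{k=1}^n x_k=0\}$. *)

theory Defs
  imports "HOL-Probability.Probability" "HOL-Combinatorics.Permutations"
begin

definition uniformly_distributed_on :: "'a measure \<Rightarrow> real set \<Rightarrow> ('a \<Rightarrow> real) \<Rightarrow> bool" where
  "uniformly_distributed_on M A X \<longleftrightarrow>
     X \<in> borel_measurable M \<and> distr M lborel X = uniform_measure lborel A"

text \<open>
  A system \<open>(X\<^sub>1, \<dots>, X\<^sub>n)\<close> is encoded as a family \<open>X\<close> of which only the members with index in
  \<open>{1..n}\<close> matter. As usual for random variables, the linear relation is an almost sure identity,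
  so that being a random balanced sample is a property of the joint distribution.
\<close>

definition random_balanced_sample :: "'a measure \<Rightarrow> nat \<Rightarrow> (nat \<Rightarrow> 'a \<Rightarrow> real) \<Rightarrow> bool" where
  "random_balanced_sample M n X \<longleftrightarrow>
     (AE \<omega> in M. (\<Sum>k=1..n. X k \<omega>) = 0) \<and>
     (\<forall>k\<in>{1..n}. uniformly_distributed_on M {-1..1} (X k))"

text \<open>
  Independence of two random elements with values in spaces of different types, which rules out
  \<^const>\<open>prob_space.indep_var\<close>: the sigma-algebras they generate are independent.
\<close>

definition independent_elements ::
    "'a measure \<Rightarrow> 'b measure \<Rightarrow> ('a \<Rightarrow> 'b) \<Rightarrow> 'c measure \<Rightarrow> ('a \<Rightarrow> 'c) \<Rightarrow> bool" where
  "independent_elements M N1 Z1 N2 Z2 \<longleftrightarrow>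
     Z1 \<in> M \<rightarrow>\<^sub>M N1 \<and> Z2 \<in> M \<rightarrow>\<^sub>M N2 \<and>
     prob_space.indep_set M
       (sets (vimage_algebra (space M) Z1 N1)) (sets (vimage_algebra (space M) Z2 N2))"

text \<open>
  Points of \<open>\<real>\<^sup>n\<close> are functions on \<open>{1..n}\<close> that are \<^const>\<open>undefined\<close> elsewhere, as in
  \<^const>\<open>PiM\<close> and \<^term>\<open>powertop_real {1..n}\<close>.
\<close>

abbreviation Rn_borel :: "nat \<Rightarrow> (nat \<Rightarrow> real) measure" where
  "Rn_borel n \<equiv> PiM {1..n} (\<lambda>_. borel)"

definition random_vector :: "nat \<Rightarrow> (nat \<Rightarrow> 'a \<Rightarrow> real) \<Rightarrow> 'a \<Rightarrow> nat \<Rightarrow> real" where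
  "random_vector n X \<omega> = (\<lambda>k\<in>{1..n}. X k \<omega>)"

definition balanced_vectors :: "nat \<Rightarrow> (nat \<Rightarrow> real) set" where
  "balanced_vectors n = {x \<in> {1..n} \<rightarrow>\<^sub>E {-1..1}. (\<Sum>k=1..n. x k) = 0}"

text \<open>
  The topological support of a measure. It is meant for measures for which all open sets of the
  topology are measurable, since \<^const>\<open>emeasure\<close> is 0 on other sets.
\<close>

definition measure_support :: "'b topology \<Rightarrow> 'b measure \<Rightarrow> 'b set" where
  "measure_support T N =
     {x \<in> topspace T. \<forall>U. openin T U \<and> x \<in> U \<longrightarrow> emeasure N U > 0}"

end

theory Submission
  imports Defs
begin

text \<open>
  Uniformity: every \<open>S\<^sub>k\<close> is a difference of two independent uniform variables, so \<open>a = S\<^sub>k/2\<close> has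
  density \<open>1 - \<bar>a\<bar>\<close> on \<open>[-1,1]\<close>, which cancels the scaling by \<open>1 - \<bar>a\<bar>\<close> of \<open>T\<^sub>k\<close>: the density of
  \<open>a + (1 - \<bar>a\<bar>) T\<^sub>k\<close> at \<open>y\<close> is half the length of \<open>{a. \<bar>a\<bar> + \<bar>y - a\<bar> \<le> 1}\<close>, that is \<open>1/2\<close>
  for \<open>\<bar>y\<bar> \<le> 1\<close>.

  Support: \<open>Y\<close> is a continuous function of independent variables, so every value it takes on the
  product of their supports is in its support. Given \<open>x\<close> in \<open>M(n)\<close>, let \<open>X\<^sub>m = y\<close> be its median, set
  \<open>B = 1\<close>, and pair each of the \<open>m\<close> larger entries with one of the \<open>m\<close> smaller ones. The pair sums
  lie in \<open>[y - 1, y + 1]\<close>, an interval of length 2, so the pairs can be ordered greedily in such a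
  way that the walk with decrements \<open>S\<^sub>k\<close> from \<open>(1 - y)/2\<close> to \<open>(1 + y)/2\<close> stays in \<open>[-1,1]\<close>. Its
  intermediate positions are the required values of \<open>X\<^sub>1, \<dots>, X\<^bsub>m-1\<^esub>\<close>.
\<close>

subsection \<open>Greedy walks and the image of the construction\<close>

text \<open>The endpoint \<open>p + sum s J\<close> is unchanged when a step is moved from
  \<open>J\<close> into \<open>p\<close>, so in the induction only the bounds on \<open>p\<close>
  have to be restored. For this it is enough to find one remaining step that keeps the walk in
  \<open>[-1,1]\<close>.\<close>

lemma bounded_path_rearrangement:
  fixes s :: "'i \<Rightarrow> real"
  assumes "finite J" and "\<And>j. j \<in> J \<Longrightarrow> - D \<le> s j \<and> s j \<le> U" and "D + U \<le> 2"
    and "- 1 \<le> p" "p \<le> 1" "D - 1 \<le> p + sum s J" "p + sum s J \<le> 1"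
  shows "\<exists>js. distinct js \<and> set js = J \<and> (\<forall>k\<le>length js. p + (\<Sum>i<k. s (js ! i)) \<in> {-1..1})"
  using assms(1,2,4-)
proof (induction "card J" arbitrary: J p)
  case 0
  then show ?case by (intro exI[of _ "[]"]) auto
next
  case (Suc c)
  then have ne: "J \<noteq> {}" by auto
  \<comment> \<open>Go down when \<open>p\<close> is at least \<open>D - 1\<close>, otherwise up; in the second case an upward step is
    left, as the walk ends above \<open>D - 1\<close>.\<close>
  have "\<exists>j\<in>J. p + s j \<in> {-1..1}"
  proof (cases "D - 1 \<le> p")
    case True
    show ?thesis
    proof (cases "\<exists>j\<in>J. s j \<le> 0")
      case True
      then obtain j where j: "j \<in> J" "s j \<le> 0" by blast
      then show ?thesis using Suc.prems(2)[of j] \<open>D - 1 \<le> p\<close> Suc.prems(4)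
        by (intro bexI[of _ j]) auto
    next
      case False
      \<comment> \<open>All remaining steps are positive, so none exceeds their total, and taking
        any of them keeps the walk at or below its endpoint.\<close>
      obtain j where j: "j \<in> J" using ne by blast
      have "s j \<le> sum s J"
        using False by (intro member_le_sum j Suc.prems(1)) (auto simp: not_le less_imp_le)
      then show ?thesis using False j Suc.prems(3,6)
        by (intro bexI[of _ j]) (auto simp: not_le dest!: bspec[of _ _ j])
    qed
  next
    case False
    then have "sum s J > 0" using Suc.prems(5) by linarith
    then obtain j where j: "j \<in> J" "s j > 0"
      by (meson not_le sum_nonpos)
    then show ?thesis using Suc.prems(2)[of j] False assms(3) Suc.prems(3)
      by (intro bexI[of _ j]) auto
  qed
  then obtain j where j: "j \<in> J" and pj: "p + s j \<in> {-1..1}" by blast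
  have sJ: "sum s J = s j + sum s (J - {j})"
    using j Suc.prems(1) by (simp add: sum.remove)
  have "\<exists>js. distinct js \<and> set js = J - {j} \<and>
      (\<forall>k\<le>length js. (p + s j) + (\<Sum>i<k. s (js ! i)) \<in> {-1..1})"
    using Suc.hyps(2) j Suc.prems pj sJ
    by (intro Suc.hyps(1)) auto
  then obtain js where js: "distinct js" "set js = J - {j}"
      "\<And>k. k \<le> length js \<Longrightarrow> (p + s j) + (\<Sum>i<k. s (js ! i)) \<in> {-1..1}" by blast
  have "p + (\<Sum>i<k. s ((j # js) ! i)) \<in> {-1..1}" if "k \<le> length (j # js)" for k
  proof (cases k)
    case 0
    then show ?thesis using Suc.prems(3,4) by simp
  next
    case (Suc l)
    then show ?thesis using js(3)[of l] that
      by (simp add: sum.lessThan_Suc_shift add.assoc del: sum.lessThan_Suc)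
  qed
  then show ?case
    using js(1,2) j by (intro exI[of _ "j # js"]) auto
qed

text \<open>
  The sources of randomness are one vector \<open>z\<close>: the coordinates \<open>Inl k\<close>, \<open>Inr (Inl k)\<close> and
  \<open>Inr (Inr ())\<close> stand for \<open>X\<^sub>k\<close>, \<open>T\<^sub>k\<close> and \<open>B\<close>. The \<open>S\<^sub>k\<close> are the decrements of the walk
  \<open>(B - X\<^sub>m)/2, X\<^sub>1, \<dots>, X\<^bsub>m-1\<^esub>, (B + X\<^sub>m)/2\<close>, where \<open>S\<^sub>m\<close> belongs to the first step; this is
  why \<open>pair_sum\<close> reduces its index modulo \<open>m\<close>.
\<close>

definition walk :: "nat \<Rightarrow> (nat + nat + unit \<Rightarrow> real) \<Rightarrow> nat \<Rightarrow> real" where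
  "walk m z k =
     (if k = 0 then (z (Inr (Inr ())) - z (Inl m)) / 2
      else if k < m then z (Inl k)
      else (z (Inr (Inr ())) + z (Inl m)) / 2)"

definition pair_sum :: "nat \<Rightarrow> (nat + nat + unit \<Rightarrow> real) \<Rightarrow> nat \<Rightarrow> real" where
  "pair_sum m z k = walk m z (k mod m) - walk m z (Suc (k mod m))"

definition sample_map :: "nat \<Rightarrow> (nat + nat + unit \<Rightarrow> real) \<Rightarrow> nat \<Rightarrow> real" where
  "sample_map m z j =
     (if j = 2 * m + 1 then z (Inl m)
      else let k = (j + 1) div 2; s = pair_sum m z k in
        s / 2 + (if odd j then 1 else - 1) * ((1 - \<bar>s\<bar> / 2) * z (Inr (Inl k))))"

text \<open>Recovers the \<open>T\<close>-coordinate of a pair from its two entries. Everything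
  rests on \<open>\<bar>a + b\<bar> + \<bar>a - b\<bar> \<le> 2\<close>; when the denominator
  vanishes, this forces \<open>a = b\<close>, so \<open>t = 0\<close>.\<close>

lemma pair_from_sum:
  fixes a b :: real
  assumes "a \<in> {-1..1}" "b \<in> {-1..1}"
  defines "t \<equiv> (a - b) / (2 - \<bar>a + b\<bar>)"
  shows "t \<in> {-1..1}" "(a + b) / 2 + (1 - \<bar>a + b\<bar> / 2) * t = a"
    "(a + b) / 2 - (1 - \<bar>a + b\<bar> / 2) * t = b"
proof -
  have *: "\<bar>a + b\<bar> + \<bar>a - b\<bar> \<le> 2" using assms(1,2) by auto
  have e: "(1 - \<bar>a + b\<bar> / 2) * t = (a - b) / 2"
  proof (cases "2 - \<bar>a + b\<bar> = 0")
    case True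
    then have "a = b" using * by linarith
    then show ?thesis by (simp add: t_def)
  next
    case False
    have "(1 - \<bar>a + b\<bar> / 2) * t = ((2 - \<bar>a + b\<bar>) * t) / 2" by (simp add: algebra_simps)
    also have "(2 - \<bar>a + b\<bar>) * t = a - b" using False by (simp add: t_def)
    finally show ?thesis .
  qed
  show "(a + b) / 2 + (1 - \<bar>a + b\<bar> / 2) * t = a" "(a + b) / 2 - (1 - \<bar>a + b\<bar> / 2) * t = b"
    unfolding e by (simp_all add: field_simps)
  have "\<bar>t\<bar> \<le> 1"
  proof (cases "2 - \<bar>a + b\<bar> = 0")
    case False
    then have "2 - \<bar>a + b\<bar> > 0" using * by linarith
    then show ?thesis using * by (simp add: t_def abs_divide)
  qed (simp add: t_def)
  then show "t \<in> {-1..1}" by (auto simp: abs_le_iff)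
qed

lemma balanced_vector_in_image:
  assumes m: "m > 1" and n: "n = 2 * m + 1" and x: "x \<in> balanced_vectors n"
  obtains p z where "p permutes {1..n}"
    and "\<And>k. k \<in> {1..m} \<Longrightarrow> z (Inl k) \<in> {-1..1}"
    and "\<And>k. k \<in> {1..m} \<Longrightarrow> z (Inr (Inl k)) \<in> {-1..1}"
    and "z (Inr (Inr ())) = 1"
    and "\<And>j. j \<in> {1..n} \<Longrightarrow> sample_map m z j = x (p j)"
proof -
  have x1: "x j \<in> {-1..1}" if "j \<in> {1..n}" for j
    using x that by (auto simp: balanced_vectors_def PiE_iff)
  have x0: "sum x {1..n} = 0" using x by (auto simp: balanced_vectors_def)
  define xs where "xs = sort_key x [1..<Suc n]"
  have xs: "distinct xs" "set xs = {1..n}" "length xs = n" "sorted (map x xs)"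
    by (auto simp: xs_def)
  have xs1: "xs ! i \<in> {1..n}" if "i < n" for i using xs that nth_mem by blast
  have mono: "x (xs ! i) \<le> x (xs ! j)" if "i \<le> j" "j < n" for i j
    using sorted_nth_mono[OF xs(4), of i j] that xs(3) by simp
  define y where "y = x (xs ! m)"
  have y: "y \<in> {-1..1}" unfolding y_def using n by (intro x1 xs1) auto
  define hi where "hi i = x (xs ! (m + 1 + i))" for i
  define lo where "lo i = x (xs ! i)" for i
  have hi: "hi i \<in> {y..1}" and lo: "lo i \<in> {-1..y}" if "i < m" for i
    using x1[OF xs1[of "m + 1 + i"]] x1[OF xs1[of i]] mono[of m "m+1+i"] mono[of i m] that n
    by (auto simp: hi_def lo_def y_def)
  \<comment> \<open>The sign is negative because \<open>pair_sum\<close> is a decrement of the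
    walk.\<close>
  define s where "s i = - (hi i + lo i)" for i
  have "0 = (\<Sum>i<n. x (xs ! i))"
    using x0 xs by (metis bij_betw_nth sum.reindex_bij_betw lessThan_atLeast0)
  also have "{..<n} = {..<m} \<union> ({m} \<union> (\<lambda>i. m + 1 + i) ` {..<m})"
    unfolding n by (auto simp: image_iff Bex_def intro: exI[of _ "_ - (m + 1)"]) presburger
  also have "(\<Sum>i\<in>\<dots>. x (xs ! i)) = (\<Sum>i<m. lo i) + (y + (\<Sum>i<m. hi i))"
    by (subst sum.union_disjoint; (subst sum.union_disjoint)?)
       (auto simp: lo_def hi_def y_def sum.reindex inj_on_def)
  finally have sums: "sum s {..<m} = y"
    by (simp add: s_def sum_subtractf sum_negf)
  \<comment> \<open>By \<open>hi i \<in> {y..1}\<close> and \<open>lo i \<in> {-1..y}\<close> the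
    steps lie in \<open>[-1 - y, 1 - y]\<close>. They add up to \<open>y\<close>, so the walk ends
    at \<open>(1 + y) / 2\<close>, which is at least \<open>D - 1 = y\<close> because
    \<open>y \<le> 1\<close>.\<close>
  have "\<exists>js. distinct js \<and> set js = {..<m} \<and>
      (\<forall>k\<le>length js. (1 - y) / 2 + (\<Sum>i<k. s (js ! i)) \<in> {-1..1})"
    by (rule bounded_path_rearrangement[where D = "1 + y" and U = "1 - y"])
       (use hi lo y sums in \<open>auto simp: s_def field_simps\<close>, (force simp: field_simps)+)
  then obtain js where js: "distinct js" "set js = {..<m}"
      and path: "\<And>k. k \<le> length js \<Longrightarrow> (1 - y) / 2 + (\<Sum>i<k. s (js ! i)) \<in> {-1..1}"
    by blast
  have len: "length js = m" using js distinct_card by fastforce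
  have jsm: "js ! i < m" if "i < m" for i using js(2) len that nth_mem by blast
  define P where "P k = (1 - y) / 2 + (\<Sum>i<k. s (js ! i))" for k
  have Pm: "P m = (1 + y) / 2"
  proof -
    have "(\<Sum>i<m. s (js ! i)) = sum s {..<m}"
      using js len by (metis bij_betw_nth sum.reindex_bij_betw lessThan_atLeast0)
    then show ?thesis by (simp add: P_def sums field_simps)
  qed
  have PS: "P k - P (Suc k) = hi (js ! k) + lo (js ! k)" for k
    by (simp add: P_def s_def)
  define t where "t i = (hi i - lo i) / (2 - \<bar>hi i + lo i\<bar>)" for i
  \<comment> \<open>Step \<open>i\<close> of the walk, counted from 0, uses the pair
    \<open>js ! i\<close>. It carries the index \<open>i\<close> in the construction, except that
    step 0 carries the index \<open>m\<close>; hence \<open>k mod m\<close>.\<close>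
  define z :: "nat + nat + unit \<Rightarrow> real" where
    "z = case_sum (\<lambda>k. if k = m then y else P k) (case_sum (\<lambda>k. t (js ! (k mod m))) (\<lambda>_. 1))"
  have walk: "walk m z k = P k" if "k \<le> m" for k
    using that Pm m by (cases "k = m") (auto simp: walk_def z_def P_def)
  have ps: "pair_sum m z k = hi (js ! (k mod m)) + lo (js ! (k mod m))" for k
    using m mod_less_divisor[of m k] by (simp add: pair_sum_def walk PS Suc_leI)
  \<comment> \<open>The rank, in sorted order, of the entry that goes to position \<open>j\<close>:
    odd positions below \<open>n\<close> receive the larger member of a pair, even ones the smaller
    member, and \<open>n\<close> the median.\<close>
  define r where "r j = (if j = n then m
      else let i = js ! (((j + 1) div 2) mod m) in if odd j then m + 1 + i else i)" for j
  have jm: "js ! (k mod m) < m" for k using m by (intro jsm) auto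
  have r_less: "r j < n" for j
    using jm[of "(j + 1) div 2"] by (auto simp: r_def Let_def n)
  have inj: "inj_on r {1..n}"
  proof (rule inj_onI)
    fix i j assume ij: "i \<in> {1..n}" "j \<in> {1..n}" and e: "r i = r j"
    \<comment> \<open>Ranks above, equal to and below \<open>m\<close> belong to odd positions other
      than \<open>n\<close>, to \<open>n\<close>, and to even positions.\<close>
    have parity: "i = n \<longleftrightarrow> j = n" "i \<noteq> n \<Longrightarrow> odd i \<longleftrightarrow> odd j"
      using e jm[of "(i + 1) div 2"] jm[of "(j + 1) div 2"]
      by (auto simp: r_def Let_def split: if_splits)
    show "i = j"
    proof (cases "i = n")
      case False
      then have "js ! (((i + 1) div 2) mod m) = js ! (((j + 1) div 2) mod m)"
        using e parity by (auto simp: r_def Let_def split: if_splits)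
      then have md: "((i + 1) div 2) mod m = ((j + 1) div 2) mod m"
        using js(1) len m by (subst (asm) nth_eq_iff_index_eq) auto
      have rng: "(i + 1) div 2 \<in> {1..m}" "(j + 1) div 2 \<in> {1..m}"
        using ij False parity(1) n by auto
      have "(i + 1) div 2 = (j + 1) div 2"
        using md rng by (cases "(i + 1) div 2 = m"; cases "(j + 1) div 2 = m") auto
      then show ?thesis using parity(2)[OF False] by presburger
    qed (use parity in auto)
  qed
  define p where "p j = (if j \<in> {1..n} then xs ! r j else j)" for j
  have "inj_on p {1..n}"
  proof (rule inj_onI)
    fix i j assume ij: "i \<in> {1..n}" "j \<in> {1..n}" and "p i = p j"
    then have "xs ! r i = xs ! r j" by (simp add: p_def)
    then have "r i = r j" using r_less[of i] r_less[of j] xs(1,3) by (simp add: nth_eq_iff_index_eq)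
    with inj ij show "i = j" by (blast dest: inj_onD)
  qed
  moreover have "p ` {1..n} \<subseteq> {1..n}" using xs1 r_less by (auto simp: p_def)
  ultimately have "bij_betw p {1..n} {1..n}"
    by (simp add: bij_betw_def endo_inj_surj)
  then have p: "p permutes {1..n}"
    by (rule bij_imp_permutes) (auto simp: p_def)
  have "t i \<in> {-1..1}" if "i < m" for i
    using hi[OF that] lo[OF that] y unfolding t_def by (intro pair_from_sum) auto
  then have zT: "z (Inr (Inl k)) \<in> {-1..1}" for k using jm[of k] by (simp add: z_def)
  have zX: "z (Inl k) \<in> {-1..1}" if "k \<in> {1..m}" for k
    using that path[of k] y len by (auto simp: z_def P_def)
  have "sample_map m z j = x (p j)" if j: "j \<in> {1..n}" for j
  proof (cases "j = n")
    case True
    then show ?thesis using n by (simp add: sample_map_def z_def p_def r_def y_def)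
  next
    case False
    define i where "i = js ! (((j + 1) div 2) mod m)"
    have i: "hi i \<in> {-1..1}" "lo i \<in> {-1..1}"
      using hi[of i] lo[of i] jm[of "(j + 1) div 2"] y by (auto simp: i_def)
    have "z (Inr (Inl ((j + 1) div 2))) = t i" by (simp add: z_def i_def)
    then have "sample_map m z j = (hi i + lo i) / 2 +
        (if odd j then 1 else - 1) * ((1 - \<bar>hi i + lo i\<bar> / 2) * t i)"
      using False n by (simp add: sample_map_def Let_def ps i_def)
    also have "\<dots> = (if odd j then hi i else lo i)"
      using pair_from_sum(2,3)[OF i] by (simp add: t_def)
    also have "\<dots> = x (p j)"
      using False j by (simp add: p_def r_def Let_def hi_def lo_def i_def)
    finally show ?thesis .
  qed
  with p zX zT show thesis by (intro that[of p z]) (auto simp: z_def)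
qed

subsection \<open>Uniform distributions\<close>

lemma ennreal_half_indicator:
  "indicator A x / 2 = ennreal (indicator A x / 2)"
  by (auto simp: indicator_def divide_ennreal[symmetric] simp del: divide_ennreal)

lemma uniform_nn_integral:
  assumes X: "uniformly_distributed_on M {-1..1} X" and [measurable]: "f \<in> borel_measurable borel"
  shows "(\<integral>\<^sup>+\<omega>. f (X \<omega>) \<partial>M) = (\<integral>\<^sup>+x. ennreal (indicator {-1..1} x / 2) * f x \<partial>lborel)"
proof -
  have [measurable]: "X \<in> borel_measurable M"
    and d: "distr M lborel X = density lborel (\<lambda>x. indicator {-1..1} x / 2)"
    using X by (auto simp: uniformly_distributed_on_def uniform_measure_def)
  have "(\<integral>\<^sup>+\<omega>. f (X \<omega>) \<partial>M) = (\<integral>\<^sup>+x. f x \<partial>distr M lborel X)"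
    by (subst nn_integral_distr) auto
  then show ?thesis unfolding d ennreal_half_indicator by (simp add: nn_integral_density)
qed

text \<open>Together with \<open>uniform_nn_integral\<close>, this turns uniformity into an identity
  of integrals of nonnegative test functions, where independence, substitution and Fubini apply
  directly.\<close>

lemma uniformI:
  assumes [measurable]: "X \<in> borel_measurable M"
    and "\<And>f. f \<in> borel_measurable borel \<Longrightarrow>
      (\<integral>\<^sup>+\<omega>. f (X \<omega>) \<partial>M) = (\<integral>\<^sup>+x. ennreal (indicator {-1..1} x / 2) * f x \<partial>lborel)"
  shows "uniformly_distributed_on M {-1..1} X"
proof -
  have "distr M lborel X = density lborel (\<lambda>x. indicator {-1..1} x / 2)"
  proof (rule measure_eqI)
    fix A assume "A \<in> sets (distr M lborel X)"
    then have [measurable]: "A \<in> sets borel" by simp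
    have "emeasure (distr M lborel X) A = (\<integral>\<^sup>+x. indicator A x \<partial>distr M lborel X)"
      by simp
    also have "\<dots> = (\<integral>\<^sup>+\<omega>. indicator A (X \<omega>) \<partial>M)"
      by (subst nn_integral_distr) auto
    also have "\<dots> = (\<integral>\<^sup>+x. ennreal (indicator {-1..1} x / 2) * indicator A x \<partial>lborel)"
      by (rule assms(2)) simp
    finally show "emeasure (distr M lborel X) A =
        emeasure (density lborel (\<lambda>x. indicator {-1..1} x / 2)) A"
      by (simp add: emeasure_density ennreal_half_indicator)
  qed simp
  then show ?thesis by (simp add: uniformly_distributed_on_def uniform_measure_def)
qed

text \<open>Reduces the start of the walk to its end, and entries with even index to those with odd
  index.\<close>

lemma uniform_uminus:
  assumes X: "uniformly_distributed_on M {-1..1} X"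
  shows "uniformly_distributed_on M {-1..1} (\<lambda>\<omega>. - X \<omega>)"
proof (rule uniformI)
  show "(\<lambda>\<omega>. - X \<omega>) \<in> borel_measurable M"
    using X by (auto simp: uniformly_distributed_on_def)
  fix f :: "real \<Rightarrow> ennreal" assume [measurable]: "f \<in> borel_measurable borel"
  show "(\<integral>\<^sup>+\<omega>. f (- X \<omega>) \<partial>M) = (\<integral>\<^sup>+x. ennreal (indicator {-1..1} x / 2) * f x \<partial>lborel)"
    unfolding uniform_nn_integral[OF X, of "\<lambda>x. f (- x)", simplified]
    by (subst (2) nn_integral_real_affine[of _ "-1" 0])
       (auto intro!: nn_integral_cong simp: indicator_def)
qed

context prob_space
begin

lemma indep_var_nn_integral:
  assumes UV: "indep_var borel (U :: 'a \<Rightarrow> real) borel (V :: 'a \<Rightarrow> real)"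
    and f [measurable]: "case_prod f \<in> borel_measurable (borel \<Otimes>\<^sub>M borel)"
  shows "(\<integral>\<^sup>+\<omega>. f (U \<omega>) (V \<omega>) \<partial>M) = (\<integral>\<^sup>+\<omega>. \<integral>\<^sup>+\<omega>'. f (U \<omega>) (V \<omega>') \<partial>M \<partial>M)"
proof -
  have [measurable]: "U \<in> borel_measurable M" "V \<in> borel_measurable M"
    and d: "distr M borel U \<Otimes>\<^sub>M distr M borel V = distr M (borel \<Otimes>\<^sub>M borel) (\<lambda>\<omega>. (U \<omega>, V \<omega>))"
    using UV unfolding indep_var_distribution_eq by auto
  interpret V: prob_space "distr M borel V" by (rule prob_space_distr) simp
  have "(\<integral>\<^sup>+\<omega>. f (U \<omega>) (V \<omega>) \<partial>M) =
      (\<integral>\<^sup>+z. case_prod f z \<partial>(distr M borel U \<Otimes>\<^sub>M distr M borel V))"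
    unfolding d by (subst nn_integral_distr) auto
  also have "\<dots> = (\<integral>\<^sup>+u. \<integral>\<^sup>+v. f u v \<partial>distr M borel V \<partial>distr M borel U)"
    by (subst V.nn_integral_fst[symmetric]) (auto cong: measurable_cong_sets)
  also have "\<dots> = (\<integral>\<^sup>+\<omega>. \<integral>\<^sup>+v. f (U \<omega>) v \<partial>distr M borel V \<partial>M)"
    by (subst nn_integral_distr) auto
  also have "\<dots> = (\<integral>\<^sup>+\<omega>. \<integral>\<^sup>+\<omega>'. f (U \<omega>) (V \<omega>') \<partial>M \<partial>M)"
    by (subst nn_integral_distr) auto
  finally show ?thesis .
qed

text \<open>Given \<open>B = -1\<close> the average is uniform on \<open>[-1,0]\<close>, given
  \<open>B = 1\<close> it is uniform on \<open>[0,1]\<close>. The equal mixture of the two is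
  uniform on \<open>[-1,1]\<close>.\<close>

lemma uniform_average_with_sign:
  assumes X: "uniformly_distributed_on M {-1..1} X" and BX: "indep_var borel B borel X"
    and B: "prob {\<omega> \<in> space M. B \<omega> = -1} = 1 / 2" "prob {\<omega> \<in> space M. B \<omega> = 1} = 1 / 2"
  shows "uniformly_distributed_on M {-1..1} (\<lambda>\<omega>. (B \<omega> + X \<omega>) / 2)"
proof (rule uniformI)
  have [measurable]: "B \<in> borel_measurable M" "X \<in> borel_measurable M"
    using BX by (auto dest: indep_var_rv1 indep_var_rv2)
  show "(\<lambda>\<omega>. (B \<omega> + X \<omega>) / 2) \<in> borel_measurable M" by simp
  fix f :: "real \<Rightarrow> ennreal" assume [measurable]: "f \<in> borel_measurable borel"
  define h where "h b = (\<integral>\<^sup>+x. ennreal (indicator {-1..1} x / 2) * f ((b + x) / 2) \<partial>lborel)" for b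
  have h1: "h 1 = (\<integral>\<^sup>+x. indicator {0..1} x * f x \<partial>lborel)"
    unfolding h_def
    by (subst nn_integral_real_affine[of _ 2 "-1"], simp, simp, subst nn_integral_cmult[symmetric], simp)
       (auto intro!: nn_integral_cong simp: indicator_def mult.assoc[symmetric] ennreal_mult[symmetric]
        simp flip: ennreal_numeral)
  have h2: "h (-1) = (\<integral>\<^sup>+x. indicator {-1..0} x * f x \<partial>lborel)"
    unfolding h_def
    by (subst nn_integral_real_affine[of _ 2 "1"], simp, simp, subst nn_integral_cmult[symmetric], simp)
       (auto intro!: nn_integral_cong simp: indicator_def mult.assoc[symmetric] ennreal_mult[symmetric]
        simp flip: ennreal_numeral)
  have "prob ({\<omega> \<in> space M. B \<omega> = -1} \<union> {\<omega> \<in> space M. B \<omega> = 1}) = 1"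
    by (subst finite_measure_Union) (auto simp: B)
  then have "AE \<omega> in M. \<omega> \<in> {\<omega> \<in> space M. B \<omega> = -1} \<union> {\<omega> \<in> space M. B \<omega> = 1}"
    by (intro AE_prob_1) simp
  then have ae: "AE \<omega> in M. h (B \<omega>) = h (-1) * indicator {\<omega> \<in> space M. B \<omega> = -1} \<omega>
      + h 1 * indicator {\<omega> \<in> space M. B \<omega> = 1} \<omega>"
    by eventually_elim (auto simp: indicator_def)
  have "(\<integral>\<^sup>+\<omega>. f ((B \<omega> + X \<omega>) / 2) \<partial>M) = (\<integral>\<^sup>+\<omega>. \<integral>\<^sup>+\<omega>'. f ((B \<omega> + X \<omega>') / 2) \<partial>M \<partial>M)"
    by (rule indep_var_nn_integral[OF BX]) simp
  also have "\<dots> = (\<integral>\<^sup>+\<omega>. h (B \<omega>) \<partial>M)"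
    unfolding h_def by (intro nn_integral_cong uniform_nn_integral[OF X]) simp
  also have "\<dots> = (\<integral>\<^sup>+\<omega>. h (-1) * indicator {\<omega> \<in> space M. B \<omega> = -1} \<omega>
      + h 1 * indicator {\<omega> \<in> space M. B \<omega> = 1} \<omega> \<partial>M)"
    by (rule nn_integral_cong_AE[OF ae])
  also have "\<dots> = h (-1) * ennreal (1 / 2) + h 1 * ennreal (1 / 2)"
    by (subst nn_integral_add) (auto simp: nn_integral_cmult_indicator emeasure_eq_measure B)
  also have "\<dots> = (\<integral>\<^sup>+x. indicator {-1..0} x * f x * ennreal (1 / 2) +
      indicator {0..1} x * f x * ennreal (1 / 2) \<partial>lborel)"
    unfolding h1 h2
    by (subst nn_integral_add; (subst nn_integral_multc)?; (subst nn_integral_multc)?) auto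
  also have "\<dots> = (\<integral>\<^sup>+x. ennreal (indicator {-1..1} x / 2) * f x \<partial>lborel)"
    \<comment> \<open>The two closed halves overlap in 0, a null set.\<close>
    by (intro nn_integral_cong_AE AE_I[of _ _ "{0}"])
       (auto simp: indicator_def mult.commute split: if_splits)
  finally show "(\<integral>\<^sup>+\<omega>. f ((B \<omega> + X \<omega>) / 2) \<partial>M) =
      (\<integral>\<^sup>+x. ennreal (indicator {-1..1} x / 2) * f x \<partial>lborel)" .
qed

lemma uniform_from_difference:
  assumes U: "uniformly_distributed_on M {-1..1} U" and V: "uniformly_distributed_on M {-1..1} V"
    and T: "uniformly_distributed_on M {-1..1} T"
    and UV: "indep_var borel U borel V" and ST: "indep_var borel (\<lambda>\<omega>. U \<omega> - V \<omega>) borel T"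
  defines "S \<equiv> \<lambda>\<omega>. U \<omega> - V \<omega>"
  shows "uniformly_distributed_on M {-1..1} (\<lambda>\<omega>. S \<omega> / 2 + (1 - \<bar>S \<omega>\<bar> / 2) * T \<omega>)"
proof (rule uniformI)
  have [measurable]: "U \<in> borel_measurable M" "V \<in> borel_measurable M" "T \<in> borel_measurable M"
    using U V T by (auto simp: uniformly_distributed_on_def)
  show "(\<lambda>\<omega>. S \<omega> / 2 + (1 - \<bar>S \<omega>\<bar> / 2) * T \<omega>) \<in> borel_measurable M"
    unfolding S_def by simp
  fix f :: "real \<Rightarrow> ennreal" assume [measurable]: "f \<in> borel_measurable borel"
  define u where "u x = ennreal (indicator {-1..1} x / 2)" for x :: real
  have [measurable]: "u \<in> borel_measurable borel" unfolding u_def by simp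
  define h where "h s = (\<integral>\<^sup>+t. u t * f (s / 2 + (1 - \<bar>s\<bar> / 2) * t) \<partial>lborel)" for s
  have [measurable]: "h \<in> borel_measurable borel" unfolding h_def by measurable
  \<comment> \<open>The triangular density of \<open>U - V\<close>: the product of the two uniform
    densities is \<open>1 / 4\<close> on an interval of length \<open>2 - \<bar>s\<bar>\<close>,
    which is empty for \<open>\<bar>s\<bar> > 2\<close>.\<close>
  have L: "(\<integral>\<^sup>+v. u (s + v) * u v \<partial>lborel) = ennreal (max 0 (2 - \<bar>s\<bar>) / 4)" for s
  proof -
    have "(\<integral>\<^sup>+v. u (s + v) * u v \<partial>lborel) =
        (\<integral>\<^sup>+v. ennreal (1 / 4) * indicator {max (-1) (-1-s) .. min 1 (1-s)} v \<partial>lborel)"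
      by (intro nn_integral_cong) (auto simp: u_def indicator_def simp flip: ennreal_mult)
    also have "\<dots> = ennreal (1 / 4) * ennreal (max 0 (2 - \<bar>s\<bar>))"
      by (subst nn_integral_cmult_indicator) (auto simp: emeasure_lborel_Icc_eq max_def min_def abs_if)
    also have "\<dots> = ennreal (1 / 4 * max 0 (2 - \<bar>s\<bar>))" by (rule ennreal_mult[symmetric]) auto
    finally show ?thesis by simp
  qed
  \<comment> \<open>Substitute \<open>y = s / 2 + c * t\<close> with
    \<open>c = 1 - \<bar>s\<bar> / 2\<close>. The Jacobian \<open>c\<close> is twice the triangular
    density, so no power of \<open>c\<close> remains. The values with \<open>c = 0\<close> form a
    null set and are left out.\<close>
  have hL: "h s * ennreal (max 0 (2 - \<bar>s\<bar>) / 4) =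
      (\<integral>\<^sup>+y. ennreal (1 / 4) * indicator {y. \<bar>y - s / 2\<bar> \<le> 1 - \<bar>s\<bar> / 2} y * f y \<partial>lborel)"
    if s: "\<bar>s\<bar> \<noteq> 2" for s
  proof (cases "\<bar>s\<bar> < 2")
    case True
    define c where "c = 1 - \<bar>s\<bar> / 2"
    have c: "c > 0" using True by (simp add: c_def)
    have ind: "\<bar>c * t\<bar> \<le> c \<longleftrightarrow> t \<in> {-1..1}" for t
    proof -
      have "\<bar>c * t\<bar> = c * \<bar>t\<bar>" using c by (simp add: abs_mult)
      then show ?thesis using c by (auto simp: mult_le_cancel_left2 abs_le_iff)
    qed
    have "(\<integral>\<^sup>+y. ennreal (1 / 4) * indicator {y. \<bar>y - s / 2\<bar> \<le> c} y * f y \<partial>lborel) =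
       ennreal c * (\<integral>\<^sup>+t. ennreal (1 / 4) * indicator {-1..1} t * f (s / 2 + c * t) \<partial>lborel)"
      using c by (subst nn_integral_real_affine[of _ c "s / 2"])
        (auto intro!: arg_cong2[where f = "(*)"] nn_integral_cong simp: indicator_def ind)
    also have "\<dots> = ennreal (c / 2) * (\<integral>\<^sup>+t. u t * f (s / 2 + c * t) \<partial>lborel)"
      using c by (subst (1 2) nn_integral_cmult[symmetric])
        (auto intro!: nn_integral_cong simp: u_def indicator_def mult.assoc[symmetric]
          simp flip: ennreal_mult)
    also have "c / 2 = max 0 (2 - \<bar>s\<bar>) / 4" using True by (simp add: c_def field_simps)
    finally show ?thesis by (simp add: h_def c_def mult.commute)
  next
    case False
    then have "{y. \<bar>y - s / 2\<bar> \<le> 1 - \<bar>s\<bar> / 2} = {}" using s by auto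
    then show ?thesis using False by simp
  qed
  \<comment> \<open>For \<open>\<bar>y\<bar> \<le> 1\<close> the admissible \<open>s\<close> form
    the interval \<open>[y - 1, y + 1]\<close> of length 2; for other \<open>y\<close> there are
    none.\<close>
  have len: "(\<integral>\<^sup>+s. ennreal (1 / 4) * indicator {y. \<bar>y - s / 2\<bar> \<le> 1 - \<bar>s\<bar> / 2} y * f y \<partial>lborel)
      = u y * f y" for y
  proof -
    have "(\<integral>\<^sup>+s. ennreal (1 / 4) * indicator {y. \<bar>y - s / 2\<bar> \<le> 1 - \<bar>s\<bar> / 2} y * f y \<partial>lborel) =
      (\<integral>\<^sup>+s. (ennreal (1 / 4) * indicator {-1..1} y * f y) * indicator {y - 1..y + 1} s \<partial>lborel)"
      by (intro nn_integral_cong) (auto simp: indicator_def abs_if split: if_splits)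
    also have "\<dots> = ennreal (1 / 4) * indicator {-1..1} y * f y * ennreal 2"
      by (subst nn_integral_cmult_indicator) auto
    also have "\<dots> = (ennreal (1 / 4) * ennreal 2) * indicator {-1..1} y * f y"
      by (simp only: mult_ac)
    also have "\<dots> = u y * f y"
      by (simp add: u_def indicator_def flip: ennreal_mult del: ennreal_numeral)
    finally show ?thesis .
  qed
  have "(\<integral>\<^sup>+\<omega>. f (S \<omega> / 2 + (1 - \<bar>S \<omega>\<bar> / 2) * T \<omega>) \<partial>M) =
      (\<integral>\<^sup>+\<omega>. \<integral>\<^sup>+\<omega>'. f (S \<omega> / 2 + (1 - \<bar>S \<omega>\<bar> / 2) * T \<omega>') \<partial>M \<partial>M)"
    unfolding S_def by (rule indep_var_nn_integral[OF ST]) simp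
  also have "\<dots> = (\<integral>\<^sup>+\<omega>. h (U \<omega> - V \<omega>) \<partial>M)"
    unfolding h_def u_def S_def by (intro nn_integral_cong uniform_nn_integral[OF T]) simp
  also have "\<dots> = (\<integral>\<^sup>+\<omega>. \<integral>\<^sup>+\<omega>'. h (U \<omega> - V \<omega>') \<partial>M \<partial>M)"
    by (rule indep_var_nn_integral[OF UV]) simp
  also have "\<dots> = (\<integral>\<^sup>+\<omega>. \<integral>\<^sup>+v. u v * h (U \<omega> - v) \<partial>lborel \<partial>M)"
    unfolding u_def by (intro nn_integral_cong uniform_nn_integral[OF V]) simp
  also have "\<dots> = (\<integral>\<^sup>+x. u x * (\<integral>\<^sup>+v. u v * h (x - v) \<partial>lborel) \<partial>lborel)"
    unfolding u_def by (rule uniform_nn_integral[OF U]) simp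
  also have "\<dots> = (\<integral>\<^sup>+x. \<integral>\<^sup>+v. u x * (u v * h (x - v)) \<partial>lborel \<partial>lborel)"
    by (intro nn_integral_cong nn_integral_cmult[symmetric]) simp
  also have "\<dots> = (\<integral>\<^sup>+v. \<integral>\<^sup>+x. u x * (u v * h (x - v)) \<partial>lborel \<partial>lborel)"
    by (rule lborel_pair.Fubini') simp
  \<comment> \<open>Substituting \<open>x = s + v\<close> frees \<open>h\<close> from
    \<open>v\<close>, so that after exchanging the integrals the one over \<open>v\<close> is the
    density computed in \<open>L\<close>.\<close>
  also have "\<dots> = (\<integral>\<^sup>+v. \<integral>\<^sup>+s. u (s + v) * (u v * h s) \<partial>lborel \<partial>lborel)"
  proof (rule nn_integral_cong)
    fix v
    show "(\<integral>\<^sup>+x. u x * (u v * h (x - v)) \<partial>lborel) = (\<integral>\<^sup>+s. u (s + v) * (u v * h s) \<partial>lborel)"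
      by (subst nn_integral_real_affine[of _ 1 v]) (auto simp: add.commute)
  qed
  also have "\<dots> = (\<integral>\<^sup>+s. \<integral>\<^sup>+v. u (s + v) * (u v * h s) \<partial>lborel \<partial>lborel)"
    by (rule lborel_pair.Fubini') simp
  also have "\<dots> = (\<integral>\<^sup>+s. h s * ennreal (max 0 (2 - \<bar>s\<bar>) / 4) \<partial>lborel)"
    unfolding L[symmetric]
    by (subst nn_integral_cmult[symmetric]) (auto intro!: nn_integral_cong simp: mult_ac)
  also have "\<dots> = (\<integral>\<^sup>+s. \<integral>\<^sup>+y. ennreal (1 / 4) *
      indicator {y. \<bar>y - s / 2\<bar> \<le> 1 - \<bar>s\<bar> / 2} y * f y \<partial>lborel \<partial>lborel)"
  proof (rule nn_integral_cong_AE)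
    show "AE s in lborel. h s * ennreal (max 0 (2 - \<bar>s\<bar>) / 4) = (\<integral>\<^sup>+y. ennreal (1 / 4) *
        indicator {y. \<bar>y - s / 2\<bar> \<le> 1 - \<bar>s\<bar> / 2} y * f y \<partial>lborel)"
      using AE_lborel_singleton[of 2] AE_lborel_singleton[of "-2"]
      by eventually_elim (rule hL, auto)
  qed
  also have "\<dots> = (\<integral>\<^sup>+y. \<integral>\<^sup>+s. ennreal (1 / 4) *
      indicator {y. \<bar>y - s / 2\<bar> \<le> 1 - \<bar>s\<bar> / 2} y * f y \<partial>lborel \<partial>lborel)"
    by (rule lborel_pair.Fubini') (simp add: indicator_def)
  also have "\<dots> = (\<integral>\<^sup>+y. u y * f y \<partial>lborel)" unfolding len ..
  finally show "(\<integral>\<^sup>+\<omega>. f (S \<omega> / 2 + (1 - \<bar>S \<omega>\<bar> / 2) * T \<omega>) \<partial>M) =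
      (\<integral>\<^sup>+x. ennreal (indicator {-1..1} x / 2) * f x \<partial>lborel)"
    by (simp add: u_def)
qed

end

subsection \<open>The law of the construction\<close>

text \<open>The \<open>T\<close>-terms cancel within each pair, and the pair sums telescope along
  the walk to \<open>(B - X\<^sub>m)/2 - (B + X\<^sub>m)/2 = - X\<^sub>m\<close>, which cancels
  against the last entry.\<close>

lemma sum_sample_map:
  assumes "m > 1"
  shows "(\<Sum>j=1..2 * m + 1. sample_map m z j) = 0"
proof -
  have pair: "sample_map m z (2 * k - 1) + sample_map m z (2 * k) = pair_sum m z k"
    if "k \<in> {1..m}" for k
  proof -
    have "odd (2 * k - 1)" "(2 * k - 1 + 1) div 2 = k" "2 * k - 1 \<noteq> 2 * m + 1"
      using that by auto
    then show ?thesis using that by (simp add: sample_map_def Let_def)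
  qed
  have "(\<Sum>j=1..2 * l. sample_map m z j) = (\<Sum>k=1..l. pair_sum m z k)" if "l \<le> m" for l
    using that
  proof (induction l)
    case (Suc l)
    then show ?case using pair[of "Suc l"] by (simp add: add.assoc)
  qed simp
  then have "(\<Sum>j=1..2 * m. sample_map m z j) = (\<Sum>k=1..m. pair_sum m z k)" by simp
  also obtain m' where m': "m = Suc m'" using assms by (cases m) auto
  \<comment> \<open>The term \<open>k = m\<close> is the first step of the walk and is moved to the
    front before telescoping.\<close>
  have "(\<Sum>k=1..m. pair_sum m z k) =
      (\<Sum>k=1..m'. walk m z k - walk m z (Suc k)) + (walk m z 0 - walk m z (Suc 0))"
    unfolding m' by (auto simp: pair_sum_def intro!: sum.cong)
  also have "\<dots> = (\<Sum>k<m. walk m z k - walk m z (Suc k))"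
    unfolding m' lessThan_Suc_atMost atMost_atLeast0 by (simp add: sum.atLeast_Suc_atMost)
  also have "\<dots> = walk m z 0 - walk m z m"
    by (rule sum_lessThan_telescope')
  also have "\<dots> = - z (Inl m)"
    using assms by (simp add: walk_def field_simps)
  finally show ?thesis by (simp add: sample_map_def)
qed

text \<open>The coordinates that position \<open>k\<close> depends on. Among the positions
  \<open>0\<close> to \<open>m\<close> only the two ends share coordinates, and for
  \<open>m > 1\<close> these are not neighbours; so neighbouring positions are independent.\<close>

definition walk_coords :: "nat \<Rightarrow> nat \<Rightarrow> (nat + nat + unit) set" where
  "walk_coords m k = (if k = 0 \<or> m \<le> k then {Inl m, Inr (Inr ())} else {Inl k})"

lemma walk_restrict: "walk_coords m k \<subseteq> A \<Longrightarrow> walk m (restrict z A) k = walk m z k"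
  by (auto simp: walk_coords_def walk_def split: if_splits)

lemma measurable_walk:
  assumes "walk_coords m k \<subseteq> A"
  shows "(\<lambda>z. walk m z k) \<in> borel_measurable (PiM A (\<lambda>_. borel))"
proof -
  have [measurable]: "(\<lambda>z. z i) \<in> borel_measurable (PiM A (\<lambda>_. borel))" if "i \<in> walk_coords m k" for i
    using that assms by (intro measurable_component_singleton) auto
  show ?thesis
    by (cases "k = 0 \<or> m \<le> k"; cases "k = 0") (simp_all add: walk_def walk_coords_def)
qed

context prob_space
begin

text \<open>The equations for \<open>restrict\<close> say that \<open>f\<close> and \<open>g\<close>
  depend only on the coordinates in \<open>A\<close> and \<open>C\<close>, so both can be evaluated
  at the full family.\<close>

lemma indep_var_of_disjoint_coordinates:
  fixes f g :: "('i \<Rightarrow> real) \<Rightarrow> real"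
  assumes Z: "indep_vars (\<lambda>_. borel) Z I" and "A \<inter> C = {}" "A \<subseteq> I" "C \<subseteq> I"
    and "f \<in> borel_measurable (PiM A (\<lambda>_. borel))" "\<And>z. f (restrict z A) = f z"
    and "g \<in> borel_measurable (PiM C (\<lambda>_. borel))" "\<And>z. g (restrict z C) = g z"
  shows "indep_var borel (\<lambda>\<omega>. f (\<lambda>i. Z i \<omega>)) borel (\<lambda>\<omega>. g (\<lambda>i. Z i \<omega>))"
  using indep_var_compose[OF indep_var_restrict[OF Z assms(2-4)] assms(5,7)]
  by (simp add: comp_def assms(6,8))

context
  fixes m :: nat and Z :: "nat + nat + unit \<Rightarrow> 'a \<Rightarrow> real"
  assumes m: "m > 1"
    and Z_unif: "\<And>k. k \<in> {1..m} \<Longrightarrow> uniformly_distributed_on M {-1..1} (Z (Inl k))"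
      "\<And>k. k \<in> {1..m} \<Longrightarrow> uniformly_distributed_on M {-1..1} (Z (Inr (Inl k)))"
    and Z_sign: "prob {\<omega> \<in> space M. Z (Inr (Inr ())) \<omega> = -1} = 1 / 2"
      "prob {\<omega> \<in> space M. Z (Inr (Inr ())) \<omega> = 1} = 1 / 2"
    and Z_indep: "indep_vars (\<lambda>_. borel) Z ({1..m} <+> {1..m} <+> {()})"
begin

text \<open>Inner positions are the \<open>X\<^sub>k\<close> themselves. The ends average the sign
  with \<open>- X\<^sub>m\<close> and with \<open>X\<^sub>m\<close>; the factor \<open>c\<close> in
  the proof covers both cases.\<close>

lemma uniform_walk:
  assumes "k \<le> m"
  shows "uniformly_distributed_on M {-1..1} (\<lambda>\<omega>. walk m (\<lambda>i. Z i \<omega>) k)"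
proof -
  have "indep_var borel (\<lambda>\<omega>. Z (Inr (Inr ())) \<omega>) borel (\<lambda>\<omega>. c * Z (Inl m) \<omega>)" for c
    by (rule indep_var_of_disjoint_coordinates[OF Z_indep, where A = "{Inr (Inr ())}" and
          C = "{Inl m}" and f = "\<lambda>z. z (Inr (Inr ()))" and g = "\<lambda>z. c * z (Inl m)"])
       (use m in auto)
  note * = this[of 1] this[of "- 1"]
  have Zm: "uniformly_distributed_on M {-1..1} (Z (Inl m))" using m Z_unif by simp
  consider "k = 0" | "k = m" | "k \<in> {1..m}" "k < m" using assms by fastforce
  then show ?thesis
  proof cases
    case 1
    then show ?thesis
      using uniform_average_with_sign[OF uniform_uminus[OF Zm] _ Z_sign] *(2)
      by (simp add: walk_def)
  next
    case 2
    then show ?thesis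
      using uniform_average_with_sign[OF Zm _ Z_sign] *(1) m by (simp add: walk_def)
  next
    case 3
    then show ?thesis using Z_unif(1)[of k] by (simp add: walk_def)
  qed
qed

text \<open>\<open>uniform_from_difference\<close> is applied to two neighbouring positions of the
  walk, with \<open>T\<^sub>k\<close> for an odd index and \<open>- T\<^sub>k\<close> for an even
  one.\<close>

lemma uniform_sample_map:
  assumes "j \<in> {1..2 * m + 1}"
  shows "uniformly_distributed_on M {-1..1} (\<lambda>\<omega>. sample_map m (\<lambda>i. Z i \<omega>) j)"
proof (cases "j = 2 * m + 1")
  case True
  then show ?thesis using Z_unif m by (simp add: sample_map_def)
next
  case False
  define k where "k = (j + 1) div 2"
  define l where "l = k mod m"
  have k: "k \<in> {1..m}" using False assms by (auto simp: k_def)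
  have l: "l < m" using m by (simp add: l_def)
  let ?z = "\<lambda>\<omega> i. Z i \<omega>"
  have sub: "walk_coords m l \<subseteq> {1..m} <+> {1..m} <+> {()}"
    "walk_coords m (Suc l) \<subseteq> {1..m} <+> {1..m} <+> {()}"
    using m l by (auto simp: walk_coords_def)
  have UV: "indep_var borel (\<lambda>\<omega>. walk m (?z \<omega>) l) borel (\<lambda>\<omega>. walk m (?z \<omega>) (Suc l))"
    by (rule indep_var_of_disjoint_coordinates[OF Z_indep, where A = "walk_coords m l" and
          C = "walk_coords m (Suc l)" and f = "\<lambda>z. walk m z l" and g = "\<lambda>z. walk m z (Suc l)"])
       (use sub l m in \<open>auto simp: walk_restrict measurable_walk\<close>, auto simp: walk_coords_def split: if_splits)
  have ST: "indep_var borel (\<lambda>\<omega>. walk m (?z \<omega>) l - walk m (?z \<omega>) (Suc l)) borel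
      (\<lambda>\<omega>. c * Z (Inr (Inl k)) \<omega>)" for c
    by (rule indep_var_of_disjoint_coordinates[OF Z_indep, where
          A = "walk_coords m l \<union> walk_coords m (Suc l)" and C = "{Inr (Inl k)}" and
          f = "\<lambda>z. walk m z l - walk m z (Suc l)" and g = "\<lambda>z. c * z (Inr (Inl k))"])
       (use sub k in \<open>auto simp: walk_restrict intro!: borel_measurable_diff measurable_walk\<close>,
         auto simp: walk_coords_def split: if_splits)
  have U: "uniformly_distributed_on M {-1..1} (\<lambda>\<omega>. walk m (?z \<omega>) l)"
    and V: "uniformly_distributed_on M {-1..1} (\<lambda>\<omega>. walk m (?z \<omega>) (Suc l))"
    using l by (auto intro!: uniform_walk)
  show ?thesis
  proof (cases "odd j")
    case True
    then show ?thesis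
      using uniform_from_difference[OF U V Z_unif(2)[OF k] UV] ST[of 1] False
      by (simp add: sample_map_def Let_def pair_sum_def l_def k_def)
  next
    case even: False
    then show ?thesis
      using uniform_from_difference[OF U V uniform_uminus[OF Z_unif(2)[OF k]] UV] ST[of "-1"] False
      by (simp add: sample_map_def Let_def pair_sum_def l_def k_def)
  qed
qed

end

end

subsection \<open>Random permutation and support\<close>

text \<open>On the space of all functions on a countable type, open sets are known to be measurable
  for the product. So \<open>U\<close> is pulled back to that space along restriction, and the
  result is pulled back along extension by 0.\<close>

lemma openin_powertop_real_measurable:
  fixes I :: "'i :: countable set"
  assumes "openin (powertop_real I) U"
  shows "U \<in> sets (PiM I (\<lambda>_. borel))"
proof -
  let ?N = "PiM I (\<lambda>_. borel :: real measure)"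
  let ?ext = "\<lambda>x i. if i \<in> I then x i else (0 :: real)"
  have top: "topspace (powertop_real I) = space ?N"
    by (simp add: space_PiM)
  have "continuous_map euclidean (powertop_real I) (\<lambda>x :: 'i \<Rightarrow> real. restrict x I)"
    by (auto simp: continuous_map_componentwise)
  then have "openin euclidean {x \<in> topspace euclidean. restrict x I \<in> U}"
    using assms by (rule openin_continuous_map_preimage)
  then have V: "{x. restrict x I \<in> U} \<in> sets (PiM UNIV (\<lambda>_. borel))"
    unfolding sets_PiM_equal_borel by simp
  have ext: "?ext \<in> ?N \<rightarrow>\<^sub>M PiM UNIV (\<lambda>_. borel)"
  proof (rule measurable_PiM_single')
    fix i
    show "(\<lambda>x. ?ext x i) \<in> borel_measurable ?N"
      by (cases "i \<in> I") (simp_all add: measurable_component_singleton)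
  qed auto
  have restr: "restrict (?ext x) I = x" if "x \<in> space ?N" for x
    using that by (auto simp: space_PiM PiE_def extensional_def fun_eq_iff)
  have "U \<subseteq> space ?N" using openin_subset[OF assms] top by simp
  then have "U = ?ext -` {x. restrict x I \<in> U} \<inter> space ?N"
    using restr by fastforce
  also have "\<dots> \<in> sets ?N"
    using ext V by (rule measurable_sets)
  finally show ?thesis .
qed

lemma continuous_on_sample_map: "continuous_on UNIV (\<lambda>z. sample_map m z j)"
proof -
  have [continuous_intros]: "continuous_on UNIV (\<lambda>z. walk m z k)" for k
    by (cases "k = 0"; cases "k < m") (auto simp: walk_def intro!: continuous_intros)
  have [continuous_intros]: "continuous_on UNIV (\<lambda>z. pair_sum m z k)" for k
    unfolding pair_sum_def by (intro continuous_intros)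
  show ?thesis
    by (cases "j = 2 * m + 1") (auto simp: sample_map_def Let_def intro!: continuous_intros)
qed

text \<open>Continuity is stated on the space of all functions, whereas the random sources determine
  only finitely many coordinates; this bridges the two.\<close>

lemma sample_map_cong:
  assumes "m > 1" "j \<in> {1..2 * m + 1}"
    and "\<And>i. i \<in> {1..m} <+> {1..m} <+> {()} \<Longrightarrow> z i = z' i"
  shows "sample_map m z j = sample_map m z' j"
proof -
  have w: "walk m z k = walk m z' k" for k
    using assms(1,3) by (auto simp: walk_def Plus_def)
  show ?thesis
  proof (cases "j = 2 * m + 1")
    case False
    then have "(j + 1) div 2 \<in> {1..m}" using assms(2) by auto
    then have "z (Inr (Inl ((j + 1) div 2))) = z' (Inr (Inl ((j + 1) div 2)))"
      by (intro assms(3)) auto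
    then show ?thesis by (simp only: sample_map_def pair_sum_def w Let_def False if_False)
  qed (use assms(1) assms(3)[of "Inl m"] in \<open>auto simp: sample_map_def Plus_def\<close>)
qed

lemma (in prob_space) uniform_prob_pos:
  assumes X: "uniformly_distributed_on M {-1..1} X" and U: "open U" and x: "x \<in> U" "x \<in> {-1..1}"
  shows "prob (X -` U \<inter> space M) > 0"
proof -
  obtain e where e: "e > 0" "ball x e \<subseteq> U" using U x(1) by (auto simp: open_contains_ball)
  \<comment> \<open>After truncation to \<open>[-1,1]\<close> the interval is still nondegenerate,
    even if \<open>x\<close> is an endpoint.\<close>
  define a where "a = max (-1) (x - e / 2)"
  define b where "b = min 1 (x + e / 2)"
  have ab: "a < b" "{a..b} \<subseteq> {-1..1} \<inter> U"
    using e x by (auto simp: a_def b_def dist_real_def subset_iff abs_le_iff)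
  have [measurable]: "X \<in> borel_measurable M" "U \<in> sets borel"
    using X U by (auto simp: uniformly_distributed_on_def)
  have "emeasure M (X -` U \<inter> space M) = emeasure (uniform_measure lborel {-1..1}) U"
    using X by (simp add: uniformly_distributed_on_def flip: emeasure_distr[of X M lborel])
  also have "\<dots> = emeasure lborel ({-1..1} \<inter> U) / 2" by simp
  finally have e: "emeasure M (X -` U \<inter> space M) = emeasure lborel ({-1..1} \<inter> U) / 2" .
  have "0 < emeasure lborel {a..b}" using ab(1) by simp
  also have "\<dots> \<le> emeasure lborel ({-1..1} \<inter> U)" using ab(2) by (intro emeasure_mono) auto
  finally have "0 < emeasure M (X -` U \<inter> space M)"
    unfolding e by (simp add: ennreal_zero_less_divide)
  then show ?thesis by (simp add: emeasure_eq_measure)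
qed

section \<open>Vectors shuffled by an independent random permutation\<close>

context prob_space
begin

context
  fixes n :: nat and Y W :: "nat \<Rightarrow> 'a \<Rightarrow> real" and \<sigma> :: "'a \<Rightarrow> nat \<Rightarrow> nat"
  assumes \<sigma>_meas: "\<sigma> \<in> M \<rightarrow>\<^sub>M count_space {p. p permutes {1..n}}"
    and \<sigma>_distr: "distr M (count_space {p. p permutes {1..n}}) \<sigma> =
        uniform_count_measure {p. p permutes {1..n}}"
    and \<sigma>_indep: "independent_elements M
      (count_space {p. p permutes {1..n}}) \<sigma> (Rn_borel n) (random_vector n Y)"
    and W: "\<And>k \<omega>. k \<in> {1..n} \<Longrightarrow> \<omega> \<in> space M \<Longrightarrow> W k \<omega> = Y (\<sigma> \<omega> k) \<omega>"
begin

lemma permutation_values: "\<omega> \<in> space M \<Longrightarrow> \<sigma> \<omega> permutes {1..n}"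
  using measurable_space[OF \<sigma>_meas] by simp

lemma permutation_event: "p permutes {1..n} \<Longrightarrow> \<sigma> -` {p} \<inter> space M \<in> events"
  using measurable_sets[OF \<sigma>_meas] by simp

lemma prob_permutation:
  assumes "p permutes {1..n}"
  shows "prob (\<sigma> -` {p} \<inter> space M) = 1 / fact n"
proof -
  have "prob (\<sigma> -` {p} \<inter> space M) = measure (uniform_count_measure {p. p permutes {1..n}}) {p}"
    unfolding \<sigma>_distr[symmetric] using assms by (subst measure_distr[OF \<sigma>_meas]) auto
  also have "\<dots> = 1 / fact n"
    using assms card_permutations[of "{1..n}" n]
    by (subst measure_uniform_count_measure) (auto simp: finite_permutations)
  finally show ?thesis .
qed

lemma prob_permutation_vector:
  assumes p: "p permutes {1..n}" and E: "E \<in> sets (Rn_borel n)"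
  shows "prob (\<sigma> -` {p} \<inter> space M \<inter> (random_vector n Y -` E \<inter> space M)) =
    prob (random_vector n Y -` E \<inter> space M) / fact n"
proof -
  have "indep_set (sets (vimage_algebra (space M) \<sigma> (count_space {p. p permutes {1..n}})))
      (sets (vimage_algebra (space M) (random_vector n Y) (Rn_borel n)))"
    using \<sigma>_indep by (simp add: independent_elements_def)
  from indep_setD[OF this in_vimage_algebra in_vimage_algebra, of "{p}" E] p E
  show ?thesis by (simp add: prob_permutation[OF p])
qed

lemma random_vector_measurable [measurable]: "random_vector n Y \<in> M \<rightarrow>\<^sub>M Rn_borel n"
  using \<sigma>_indep by (simp add: independent_elements_def)

lemma coordinate_event:
  "j \<in> {1..n} \<Longrightarrow> A \<in> sets borel \<Longrightarrow>
    (\<lambda>x. x j) -` A \<inter> space (Rn_borel n) \<in> sets (Rn_borel n)"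
  by (intro measurable_sets[OF measurable_component_singleton]) auto

text \<open>Splitting by the value of \<open>\<sigma>\<close> leaves events with a fixed
  permutation. They are phrased through \<open>random_vector n Y\<close> because that is the element
  independent of \<open>\<sigma>\<close>.\<close>

lemma permuted_event:
  assumes k: "k \<in> {1..n}"
  shows "W k -` A \<inter> space M = (\<Union>p\<in>{p. p permutes {1..n}}. \<sigma> -` {p} \<inter> space M \<inter>
    (random_vector n Y -` ((\<lambda>x. x (p k)) -` A \<inter> space (Rn_borel n)) \<inter> space M))"
proof -
  have "\<omega> \<in> W k -` A \<inter> space M \<longleftrightarrow> (\<exists>p. p permutes {1..n} \<and> \<sigma> \<omega> = p \<and>
      random_vector n Y \<omega> (p k) \<in> A \<and> random_vector n Y \<omega> \<in> space (Rn_borel n))"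
    if \<omega>: "\<omega> \<in> space M" for \<omega>
  proof -
    have "\<sigma> \<omega> k \<in> {1..n}"
      using permutation_values[OF \<omega>] k by (simp only: permutes_in_image)
    then have "random_vector n Y \<omega> (\<sigma> \<omega> k) = W k \<omega>"
      using W[OF k \<omega>] by (simp add: random_vector_def)
    then show ?thesis
      using permutation_values[OF \<omega>] measurable_space[OF random_vector_measurable \<omega>] \<omega> by simp
  qed
  then show ?thesis by blast
qed

lemma permuted_event_measurable:
  assumes p: "p permutes {1..n}" and k: "k \<in> {1..n}" and A: "A \<in> sets borel"
  shows "\<sigma> -` {p} \<inter> space M \<inter>
    (random_vector n Y -` ((\<lambda>x. x (p k)) -` A \<inter> space (Rn_borel n)) \<inter> space M) \<in> events"
proof -
  have "p k \<in> {1..n}" using p k by (simp only: permutes_in_image)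
  from measurable_sets[OF random_vector_measurable coordinate_event[OF this A]]
  show ?thesis by (rule sets.Int[OF permutation_event[OF p]])
qed

lemma permuted_measurable:
  assumes "k \<in> {1..n}"
  shows "W k \<in> borel_measurable M"
proof (rule measurableI)
  fix A :: "real set" assume "A \<in> sets borel"
  then show "W k -` A \<inter> space M \<in> events"
    unfolding permuted_event[OF assms]
    by (intro sets.finite_UN permuted_event_measurable assms) (simp_all add: finite_permutations)
qed simp

text \<open>Each \<open>p\<close> contributes the probability of \<open>Y (p k)\<close> being in
  \<open>E\<close>, divided by \<open>fact n\<close>. All entries have the same law, so the
  \<open>fact n\<close> contributions are equal and add up to the probability for
  \<open>Y k\<close>.\<close>

lemma permuted_uniform:
  assumes Y: "\<And>j. j \<in> {1..n} \<Longrightarrow> uniformly_distributed_on M A (Y j)" and k: "k \<in> {1..n}"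
  shows "uniformly_distributed_on M A (W k)"
proof -
  note [measurable] = permuted_measurable[OF k]
  have "distr M lborel (W k) = distr M lborel (Y k)"
  proof (rule measure_eqI)
    fix E assume "E \<in> sets (distr M lborel (W k))"
    then have E: "E \<in> sets borel" by simp
    let ?P = "{p. p permutes {1..n}}"
    let ?E = "\<lambda>p. (\<lambda>x. x (p k)) -` E \<inter> space (Rn_borel n)"
    let ?F = "\<lambda>p. \<sigma> -` {p} \<inter> space M \<inter> (random_vector n Y -` ?E p \<inter> space M)"
    have P: "finite ?P" "card ?P = fact n"
      by (auto simp: finite_permutations intro!: card_permutations)
    have pk: "p k \<in> {1..n}" if "p \<in> ?P" for p
      using permutes_in_image[of p "{1..n}" k] that k by blast
    have meas: "?F p \<in> events" if "p \<in> ?P" for p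
      using that k E by (intro permuted_event_measurable) auto
    have "prob (?F p) = prob (Y k -` E \<inter> space M) / fact n" if "p \<in> ?P" for p
    proof -
      have "random_vector n Y -` ?E p \<inter> space M = Y (p k) -` E \<inter> space M"
        using pk[OF that] measurable_space[OF random_vector_measurable] by (auto simp: random_vector_def)
      then have "prob (random_vector n Y -` ?E p \<inter> space M) = prob (Y (p k) -` E \<inter> space M)"
        by simp
      also have "\<dots> = measure (uniform_measure lborel A) E"
        using Y[OF pk[OF that]] E
        by (simp add: uniformly_distributed_on_def flip: measure_distr[of _ M lborel])
      also have "\<dots> = prob (Y k -` E \<inter> space M)"
        using Y[OF k] E by (simp add: uniformly_distributed_on_def flip: measure_distr[of _ M lborel])
      finally show ?thesis
        using that pk[OF that] E by (subst prob_permutation_vector) (auto intro!: coordinate_event)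
    qed
    then have "(\<Sum>p\<in>?P. prob (?F p)) = prob (Y k -` E \<inter> space M)"
      using P by simp
    moreover have "prob (\<Union>p\<in>?P. ?F p) = (\<Sum>p\<in>?P. prob (?F p))"
      using meas by (intro finite_measure_finite_Union P(1)) (auto simp: disjoint_family_on_def)
    ultimately have "prob (W k -` E \<inter> space M) = prob (Y k -` E \<inter> space M)"
      by (simp only: permuted_event[OF k])
    then show "emeasure (distr M lborel (W k)) E = emeasure (distr M lborel (Y k)) E"
      using E Y[OF k]
      by (subst (1 2) emeasure_distr) (auto simp: emeasure_eq_measure uniformly_distributed_on_def)
  qed simp
  then show ?thesis using Y[OF k] by (auto simp: uniformly_distributed_on_def)
qed

end

section \<open>Support of a balanced sample inside \<open>M(n)\<close>\<close>

lemma uniform_AE: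
  assumes "uniformly_distributed_on M {-1..1} X"
  shows "AE \<omega> in M. X \<omega> \<in> {-1..1}"
proof -
  have X: "X \<in> M \<rightarrow>\<^sub>M lborel" and d: "distr M lborel X = uniform_measure lborel {-1..1}"
    using assms by (simp_all add: uniformly_distributed_on_def)
  have "AE x in distr M lborel X. x \<in> {-1..1}"
    unfolding d by (rule AE_uniform_measureI) auto
  then show ?thesis by (subst (asm) AE_distr_iff[OF X]) auto
qed

text \<open>A closed condition that holds almost surely holds on the whole support, since otherwise
  its complement would be an open neighbourhood of measure 0. Being in \<open>M(n)\<close> is a
  conjunction of such conditions on continuous functions.\<close>

lemma support_subset_balanced:
  assumes X: "random_balanced_sample M n X"
  shows "measure_support (powertop_real {1..n}) (distr M (Rn_borel n) (random_vector n X))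
    \<subseteq> balanced_vectors n"
proof
  fix x assume x: "x \<in> measure_support (powertop_real {1..n}) (distr M (Rn_borel n) (random_vector n X))"
  have X': "\<And>k. k \<in> {1..n} \<Longrightarrow> uniformly_distributed_on M {-1..1} (X k)"
    and sum0: "AE \<omega> in M. (\<Sum>k=1..n. X k \<omega>) = 0"
    using X by (auto simp: random_balanced_sample_def)
  have X_meas: "random_vector n X \<in> M \<rightarrow>\<^sub>M Rn_borel n"
    unfolding random_vector_def using X'
    by (intro measurable_restrict) (auto simp: uniformly_distributed_on_def)
  have ext: "x \<in> {1..n} \<rightarrow>\<^sub>E UNIV" using x by (simp add: measure_support_def)
  have closed: "f x \<in> C" if f: "continuous_map (powertop_real {1..n}) euclideanreal f"
    and C: "closed C" and ae: "AE \<omega> in M. f (random_vector n X \<omega>) \<in> C" for f C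
  proof (rule ccontr)
    assume "f x \<notin> C"
    let ?U = "{y \<in> topspace (powertop_real {1..n}). f y \<in> - C}"
    have U: "openin (powertop_real {1..n}) ?U"
      using f C by (intro openin_continuous_map_preimage[of _ euclideanreal]) auto
    moreover have "x \<in> ?U" using ext \<open>f x \<notin> C\<close> by simp
    ultimately have "emeasure (distr M (Rn_borel n) (random_vector n X)) ?U > 0"
      using x by (auto simp: measure_support_def)
    moreover have "emeasure (distr M (Rn_borel n) (random_vector n X)) ?U = 0"
    proof -
      have "emeasure (distr M (Rn_borel n) (random_vector n X)) ?U =
          emeasure M (random_vector n X -` ?U \<inter> space M)"
        by (rule emeasure_distr[OF X_meas openin_powertop_real_measurable[OF U]])
      also have "random_vector n X -` ?U \<inter> space M = {\<omega> \<in> space M. random_vector n X \<omega> \<in> ?U}"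
        by blast
      also have "emeasure M \<dots> = 0"
        using ae by (intro emeasure_eq_0_AE) (auto elim: eventually_mono)
      finally show ?thesis .
    qed
    ultimately show False by simp
  qed
  have proj: "continuous_map (powertop_real {1..n}) euclideanreal (\<lambda>y. y k)" if "k \<in> {1..n}" for k
    using that by (intro continuous_map_product_projection)
  have "x k \<in> {-1..1}" if k: "k \<in> {1..n}" for k
    by (rule closed[OF proj[OF k]]) (use uniform_AE[OF X'[OF k]] k in \<open>auto simp: random_vector_def\<close>)
  moreover have "(\<Sum>k=1..n. x k) \<in> {0}"
    by (rule closed[of "\<lambda>x. \<Sum>k=1..n. x k"])
       (use sum0 proj in \<open>auto intro!: continuous_map_sum simp: random_vector_def\<close>)
  ultimately show "x \<in> balanced_vectors n"
    using ext by (auto simp: balanced_vectors_def PiE_iff)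
qed

end

section \<open>Open sets reached by independent variables\<close>

context prob_space
begin

text \<open>\<open>V\<close> contains an open box around \<open>z\<close>, and by independence the
  probability of its sides in \<open>I\<close> is a product of positive factors.\<close>

lemma indep_vars_prob_open_pos:
  fixes Z :: "'i \<Rightarrow> 'a \<Rightarrow> real"
  assumes Z: "indep_vars (\<lambda>_. borel) Z I" and I: "finite I" "I \<noteq> {}"
    and V: "open V" "z \<in> V"
    and pos: "\<And>i C. i \<in> I \<Longrightarrow> open C \<Longrightarrow> z i \<in> C \<Longrightarrow> prob (Z i -` C \<inter> space M) > 0"
  obtains E where "E \<in> events" "prob E > 0" "\<And>\<omega>. \<omega> \<in> E \<Longrightarrow> \<exists>z'\<in>V. \<forall>i\<in>I. z' i = Z i \<omega>"
proof -
  have "openin (product_topology (\<lambda>_. euclidean) UNIV) V"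
    using V(1) by (simp add: open_fun_def)
  from product_topology_open_contains_basis[OF this V(2)]
  obtain C where C: "\<And>i. z i \<in> C i" "\<And>i. open (C i)" "Pi\<^sub>E UNIV C \<subseteq> V"
    by (auto simp: PiE_iff)
  define E where "E = (\<Inter>i\<in>I. Z i -` C i \<inter> space M)"
  have "prob E = (\<Prod>i\<in>I. prob (Z i -` C i \<inter> space M))"
    unfolding E_def using C(2) by (intro indep_varsD_finite[OF Z] I) auto
  also have "\<dots> > 0" using C by (intro prod_pos pos) auto
  finally have "prob E > 0" .
  have "E \<in> events"
    unfolding E_def using I C(2) Z
    by (intro sets.finite_INT measurable_sets[of _ _ borel]) (auto simp: indep_vars_def)
  moreover note \<open>prob E > 0\<close>
  moreover have "\<exists>z'\<in>V. \<forall>i\<in>I. z' i = Z i \<omega>" if "\<omega> \<in> E" for \<omega>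
  proof
    \<comment> \<open>Coordinates outside \<open>I\<close> are filled in from \<open>z\<close>,
      which lies in the box.\<close>
    show "(\<lambda>i. if i \<in> I then Z i \<omega> else z i) \<in> V"
      using that C(1) I(2) by (intro subsetD[OF C(3)]) (auto simp: E_def split: if_splits)
  qed simp
  ultimately show thesis by (rule that)
qed

end

theorem theorem11:
  fixes M :: "'a measure" and m n :: nat
    and X T S Y W :: "nat \<Rightarrow> 'a \<Rightarrow> real" and B :: "'a \<Rightarrow> real"
    and \<sigma> :: "'a \<Rightarrow> nat \<Rightarrow> nat"
  assumes "prob_space M" and "m > 1" and "n = 2 * m + 1"
    and X_unif: "\<And>k. k \<in> {1..m} \<Longrightarrow> uniformly_distributed_on M {-1..1} (X k)"
    and T_unif: "\<And>k. k \<in> {1..m} \<Longrightarrow> uniformly_distributed_on M {-1..1} (T k)"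
    and B_unif: "B \<in> borel_measurable M"
      "measure M {\<omega> \<in> space M. B \<omega> = -1} = 1 / 2"
      "measure M {\<omega> \<in> space M. B \<omega> = 1} = 1 / 2"
    and indep: "prob_space.indep_vars M (\<lambda>_. borel)
      (case_sum X (case_sum T (\<lambda>_::unit. B))) ({1..m} <+> {1..m} <+> {()})"
    and S: "\<And>k \<omega>. k \<in> {1..m-2} \<Longrightarrow> \<omega> \<in> space M \<Longrightarrow> S k \<omega> = X k \<omega> - X (k + 1) \<omega>"
      "\<And>\<omega>. \<omega> \<in> space M \<Longrightarrow> S (m - 1) \<omega> = X (m - 1) \<omega> - 1 / 2 * (X m \<omega> + B \<omega>)"
      "\<And>\<omega>. \<omega> \<in> space M \<Longrightarrow> S m \<omega> = - (1 / 2 * (X m \<omega> - B \<omega>)) - X 1 \<omega>"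
    and Y: "\<And>k \<omega>. k \<in> {1..m} \<Longrightarrow> \<omega> \<in> space M \<Longrightarrow>
        Y (2 * k - 1) \<omega> = S k \<omega> / 2 + (1 - \<bar>S k \<omega>\<bar> / 2) * T k \<omega>"
      "\<And>k \<omega>. k \<in> {1..m} \<Longrightarrow> \<omega> \<in> space M \<Longrightarrow>
        Y (2 * k) \<omega> = S k \<omega> / 2 - (1 - \<bar>S k \<omega>\<bar> / 2) * T k \<omega>"
      "\<And>\<omega>. \<omega> \<in> space M \<Longrightarrow> Y (2 * m + 1) \<omega> = X m \<omega>"
    and \<sigma>_unif: "\<sigma> \<in> M \<rightarrow>\<^sub>M count_space {p. p permutes {1..n}}"
      "distr M (count_space {p. p permutes {1..n}}) \<sigma> =
        uniform_count_measure {p. p permutes {1..n}}"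
    and \<sigma>_indep: "independent_elements M
      (count_space {p. p permutes {1..n}}) \<sigma> (Rn_borel n) (random_vector n Y)"
    and W: "\<And>k \<omega>. k \<in> {1..n} \<Longrightarrow> \<omega> \<in> space M \<Longrightarrow> W k \<omega> = Y (\<sigma> \<omega> k) \<omega>"
  shows "random_balanced_sample M n W \<and>
    measure_support (powertop_real {1..n}) (distr M (Rn_borel n) (random_vector n W)) =
      balanced_vectors n"
proof -
  interpret prob_space M by fact
  note m = \<open>m > 1\<close> and n = \<open>n = 2 * m + 1\<close>
  define Z where "Z = case_sum X (case_sum T (\<lambda>_::unit. B))"
  let ?I = "{1..m} <+> {1..m} <+> {()}"
  note Z_indep = indep[folded Z_def]
  have Z_unif: "uniformly_distributed_on M {-1..1} (Z (Inl k))"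
    "uniformly_distributed_on M {-1..1} (Z (Inr (Inl k)))" if "k \<in> {1..m}" for k
    using X_unif[OF that] T_unif[OF that] by (simp_all add: Z_def)
  have Z_sign: "prob {\<omega> \<in> space M. Z (Inr (Inr ())) \<omega> = -1} = 1 / 2"
    "prob {\<omega> \<in> space M. Z (Inr (Inr ())) \<omega> = 1} = 1 / 2"
    using B_unif by (simp_all add: Z_def)
  have S_eq: "S k \<omega> = pair_sum m (\<lambda>i. Z i \<omega>) k" if k: "k \<in> {1..m}" and \<omega>: "\<omega> \<in> space M" for k \<omega>
  proof -
    \<comment> \<open>The index \<open>m\<close> wraps round to positions 0 and 1 of the walk, and
      \<open>m - 1\<close> leads to its end; the remaining steps join two of the
      \<open>X\<^sub>k\<close>.\<close>
    consider "k = m" | "k = m - 1" | "k \<in> {1..m-2}" using k by fastforce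
    then show ?thesis
    proof cases
      case 1
      then show ?thesis using S(3)[OF \<omega>] m by (simp add: pair_sum_def walk_def Z_def field_simps)
    next
      case 2
      then show ?thesis using S(2)[OF \<omega>] m by (simp add: pair_sum_def walk_def Z_def field_simps)
    next
      case 3
      then have "0 < k" "Suc k < m" "k mod m = k" by auto
      then show ?thesis using S(1)[OF 3 \<omega>] by (simp add: pair_sum_def walk_def Z_def)
    qed
  qed
  have Y_eq: "Y j \<omega> = sample_map m (\<lambda>i. Z i \<omega>) j" if j: "j \<in> {1..n}" and \<omega>: "\<omega> \<in> space M" for j \<omega>
  proof (cases "j = n")
    case True
    then show ?thesis using Y(3)[OF \<omega>] n by (simp add: sample_map_def Z_def)
  next
    case False
    define k where "k = (j + 1) div 2"
    have k: "k \<in> {1..m}" using j False n by (auto simp: k_def)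
    have "j = (if odd j then 2 * k - 1 else 2 * k)" unfolding k_def by presburger
    then have "Y j \<omega> = S k \<omega> / 2 + (if odd j then 1 else - 1) * ((1 - \<bar>S k \<omega>\<bar> / 2) * T k \<omega>)"
      using Y(1,2)[OF k \<omega>] by (cases "odd j") auto
    moreover have "Z (Inr (Inl k)) = T k" by (simp add: Z_def)
    ultimately show ?thesis
      using False by (simp only: sample_map_def Let_def S_eq[OF k \<omega>] n if_False flip: k_def)
  qed
  have Y_unif: "uniformly_distributed_on M {-1..1} (Y j)" if "j \<in> {1..n}" for j
  proof -
    have "uniformly_distributed_on M {-1..1} (\<lambda>\<omega>. sample_map m (\<lambda>i. Z i \<omega>) j)"
      using that n by (intro uniform_sample_map[OF m Z_unif Z_sign Z_indep]) auto
    then show ?thesis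
      using Y_eq[OF that]
      by (simp add: uniformly_distributed_on_def cong: measurable_cong distr_cong)
  qed
  note perm = \<sigma>_unif \<sigma>_indep W
  have W_unif: "uniformly_distributed_on M {-1..1} (W k)" if "k \<in> {1..n}" for k
    using permuted_uniform[OF perm Y_unif that] .
  have W_sum: "(\<Sum>k=1..n. W k \<omega>) = 0" if \<omega>: "\<omega> \<in> space M" for \<omega>
  proof -
    have "(\<Sum>k=1..n. W k \<omega>) = (\<Sum>k=1..n. Y (\<sigma> \<omega> k) \<omega>)" using W \<omega> by simp
    also have "\<dots> = (\<Sum>k=1..n. Y k \<omega>)"
      using sum.permute[OF permutation_values[OF perm \<omega>], of "\<lambda>k. Y k \<omega>"] by (simp add: comp_def)
    also have "\<dots> = 0" using sum_sample_map[OF m] Y_eq \<omega> n by simp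
    finally show ?thesis .
  qed
  have rbs: "random_balanced_sample M n W"
    using W_unif W_sum by (simp add: random_balanced_sample_def)
  have W_meas: "random_vector n W \<in> M \<rightarrow>\<^sub>M Rn_borel n"
    unfolding random_vector_def using W_unif
    by (intro measurable_restrict) (auto simp: uniformly_distributed_on_def)
  have "x \<in> measure_support (powertop_real {1..n}) (distr M (Rn_borel n) (random_vector n W))"
    if x: "x \<in> balanced_vectors n" for x
  proof -
    obtain p z where p: "p permutes {1..n}"
      and z: "\<And>k. k \<in> {1..m} \<Longrightarrow> z (Inl k) \<in> {-1..1}"
        "\<And>k. k \<in> {1..m} \<Longrightarrow> z (Inr (Inl k)) \<in> {-1..1}" "z (Inr (Inr ())) = 1"
      and xz: "\<And>j. j \<in> {1..n} \<Longrightarrow> sample_map m z j = x (p j)"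
      using balanced_vector_in_image[OF m n x] by blast
    \<comment> \<open>On the event \<open>\<sigma> = q\<close>, \<open>W k\<close> is
      \<open>Y (q k)\<close>, whose value at the sources \<open>z\<close> is
      \<open>x (p (q k)) = x k\<close>.\<close>
    define q where "q = inv p"
    have q: "q permutes {1..n}" "p (q k) = k" for k
      using p by (auto simp: q_def permutes_inv permutes_inverses)
    have qk: "q k \<in> {1..n}" if "k \<in> {1..n}" for k using q(1) that by (simp only: permutes_in_image)
    have ext: "x \<in> extensional {1..n}" using x by (auto simp: balanced_vectors_def PiE_def)
    have pos: "emeasure (distr M (Rn_borel n) (random_vector n W)) U > 0"
      if U: "openin (powertop_real {1..n}) U" "x \<in> U" for U
    proof -
      note U_meas = openin_powertop_real_measurable[OF U(1)]
      define G where "G y = (\<lambda>k\<in>{1..n}. y (q k))" for y :: "nat \<Rightarrow> real"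
      have "G (sample_map m z) = x"
        using qk xz q(2) ext by (auto simp: G_def fun_eq_iff extensional_def)
      moreover have "continuous_map euclidean (powertop_real {1..n}) (\<lambda>z. G (sample_map m z))"
        using continuous_on_sample_map by (auto simp: G_def continuous_map_componentwise)
      then have "openin euclidean {z \<in> topspace euclidean. G (sample_map m z) \<in> U}"
        using U(1) by (rule openin_continuous_map_preimage)
      ultimately have V: "open {z. G (sample_map m z) \<in> U}" "z \<in> {z. G (sample_map m z) \<in> U}"
        using U(2) by auto
      have Z_pos: "prob (Z i -` C \<inter> space M) > 0" if "i \<in> ?I" "open C" "z i \<in> C" for i C
      proof -
        consider k where "k \<in> {1..m}" "i = Inl k" | k where "k \<in> {1..m}" "i = Inr (Inl k)"
          | "i = Inr (Inr ())"
          using \<open>i \<in> ?I\<close> by (auto simp: Plus_def)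
        then show ?thesis
        proof cases
          case 3
          \<comment> \<open>The sign coordinate of \<open>z\<close> is 1, an atom of mass
            \<open>1 / 2\<close>.\<close>
          have "{\<omega> \<in> space M. B \<omega> = 1} \<subseteq> Z i -` C \<inter> space M"
            using 3 z(3) that by (auto simp: Z_def)
          moreover have "Z i -` C \<inter> space M \<in> events"
            using 3 B_unif(1) that by (intro measurable_sets[of _ _ borel]) (auto simp: Z_def)
          ultimately have "1 / 2 \<le> prob (Z i -` C \<inter> space M)"
            unfolding B_unif(3)[symmetric] by (rule finite_measure_mono)
          then show ?thesis by linarith
        qed (use that z Z_unif in \<open>auto intro!: uniform_prob_pos\<close>)
      qed
      obtain E where E: "E \<in> events" "prob E > 0"
        and EV: "\<And>\<omega>. \<omega> \<in> E \<Longrightarrow> \<exists>z'\<in>{z. G (sample_map m z) \<in> U}. \<forall>i\<in>?I. z' i = Z i \<omega>"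
        by (rule indep_vars_prob_open_pos[OF Z_indep _ _ V Z_pos]) auto
      define F where "F = G -` U \<inter> space (Rn_borel n)"
      have "G \<in> Rn_borel n \<rightarrow>\<^sub>M Rn_borel n"
        unfolding G_def using qk by (intro measurable_restrict measurable_component_singleton) auto
      then have F: "F \<in> sets (Rn_borel n)" unfolding F_def using U_meas by (rule measurable_sets)
      note Y_meas = random_vector_measurable[OF perm]
      have "E \<subseteq> random_vector n Y -` F \<inter> space M"
      proof
        fix \<omega> assume "\<omega> \<in> E"
        then have \<omega>: "\<omega> \<in> space M" using E(1) sets.sets_into_space by blast
        obtain z' where z': "G (sample_map m z') \<in> U" "\<And>i. i \<in> ?I \<Longrightarrow> z' i = Z i \<omega>"
          using EV[OF \<open>\<omega> \<in> E\<close>] by auto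
        have "Y j \<omega> = sample_map m z' j" if "j \<in> {1..n}" for j
          unfolding Y_eq[OF that \<omega>] using that z'(2) n by (intro sample_map_cong[OF m]) auto
        then have "G (random_vector n Y \<omega>) = G (sample_map m z')"
          using qk by (auto simp: G_def random_vector_def fun_eq_iff)
        then show "\<omega> \<in> random_vector n Y -` F \<inter> space M"
          using z'(1) \<omega> measurable_space[OF Y_meas \<omega>] by (simp add: F_def)
      qed
      then have "prob E \<le> prob (random_vector n Y -` F \<inter> space M)"
        by (intro finite_measure_mono measurable_sets[OF Y_meas F])
      then have "0 < prob (random_vector n Y -` F \<inter> space M) / fact n" using E(2) by simp
      \<comment> \<open>By independence, requiring \<open>\<sigma> = q\<close> as well costs only
        the factor \<open>1 / fact n\<close>, so the probability stays positive.\<close>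
      also have "\<dots> = prob (\<sigma> -` {q} \<inter> space M \<inter> (random_vector n Y -` F \<inter> space M))"
        by (rule prob_permutation_vector[OF perm q(1) F, symmetric])
      also have "\<dots> \<le> prob (random_vector n W -` U \<inter> space M)"
      proof (rule finite_measure_mono)
        show "random_vector n W -` U \<inter> space M \<in> events"
          by (rule measurable_sets[OF W_meas U_meas])
        have "random_vector n W \<omega> = G (random_vector n Y \<omega>)" if "\<omega> \<in> space M" "\<sigma> \<omega> = q" for \<omega>
          using W that qk by (auto simp: G_def random_vector_def fun_eq_iff)
        then show "\<sigma> -` {q} \<inter> space M \<inter> (random_vector n Y -` F \<inter> space M) \<subseteq>
            random_vector n W -` U \<inter> space M"
          by (auto simp: F_def)
      qed
      finally show ?thesis
        by (subst emeasure_distr[OF W_meas U_meas]) (simp add: emeasure_eq_measure)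
    qed
    then show ?thesis
      using ext by (simp add: measure_support_def PiE_def)
  qed
  then show ?thesis
    using rbs support_subset_balanced[OF rbs] by blast
qed

end
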